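(* There exist a ring $R$ and a right $R$-module $M$ such that $M$ is H-supplemented but not amply supplemented. (That is, the question "Is every H-supplemented module amply supplemented?" has a negative answer.)
   Context: All rings are associative with unity and all modules are unital right modules. $N \leq M$ means $N$ is a submodule of $M$; $N \ll M$ means $N$ is a small submodule of $M$, i.e. $N + X \neq M$ for every proper submodule $X$ of $M$. A module $M$ is called H-supplemented if for every submodule $A$ of $M$ there is a direct summand $A'$ of $M$ such that, for every submodule $X$ of $M$, $A+X=M$ holds if and only if $A'+X=M$. Equivalently, for each $X\leq M$ there exists a direct summand $D$ of $M$ such that $(X+D)/D\ll M/D$ and $(X+D)/X\ll M/X$. A module $M$ is called amply supplemented if whenever $A, B \leq M$ with $A+B=M$, there exists a submodule $P \leq B$ such that $A+P=M$ and $A\cap P\ll P$ (i.e. $B$ contains a supplement $P$ of $A$ in $M$). *)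

theory Defs
  imports Complex_Main "HOL-Algebra.Module" "HOL-Algebra.AbelCoset"
begin

(* The library locale "module" requires a commutative ring of scalars acting on the left.
   For right modules over an arbitrary ring we keep its record type, and read
   r \<odot> x as x r.  Thus x (a b) = (x a) b becomes (a \<otimes> b) \<odot> x = b \<odot> (a \<odot> x). *)

locale right_module = R?: ring R + M?: abelian_group M
  for R :: "('a, 'c) ring_scheme" (structure)
    and M :: "('a, 'b, 'd) module_scheme" (structure) +
  assumes right_smult_closed:
      "\<lbrakk>a \<in> carrier R; x \<in> carrier M\<rbrakk> \<Longrightarrow> a \<odot>\<^bsub>M\<^esub> x \<in> carrier M"
    and right_smult_distr_scalar:
      "\<lbrakk>a \<in> carrier R; b \<in> carrier R; x \<in> carrier M\<rbrakk> \<Longrightarrow>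
        (a \<oplus>\<^bsub>R\<^esub> b) \<odot>\<^bsub>M\<^esub> x = a \<odot>\<^bsub>M\<^esub> x \<oplus>\<^bsub>M\<^esub> b \<odot>\<^bsub>M\<^esub> x"
    and right_smult_distr_vector:
      "\<lbrakk>a \<in> carrier R; x \<in> carrier M; y \<in> carrier M\<rbrakk> \<Longrightarrow>
        a \<odot>\<^bsub>M\<^esub> (x \<oplus>\<^bsub>M\<^esub> y) = a \<odot>\<^bsub>M\<^esub> x \<oplus>\<^bsub>M\<^esub> a \<odot>\<^bsub>M\<^esub> y"
    and right_smult_assoc:
      "\<lbrakk>a \<in> carrier R; b \<in> carrier R; x \<in> carrier M\<rbrakk> \<Longrightarrow>
        (a \<otimes>\<^bsub>R\<^esub> b) \<odot>\<^bsub>M\<^esub> x = b \<odot>\<^bsub>M\<^esub> (a \<odot>\<^bsub>M\<^esub> x)"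
    and right_smult_one:
      "x \<in> carrier M \<Longrightarrow> \<one>\<^bsub>R\<^esub> \<odot>\<^bsub>M\<^esub> x = x"

(* The library predicate "submodule" assumes neither commutativity nor a side, so it is used
   unchanged below. *)

definition small_submodule ::
    "('a, 'c) ring_scheme \<Rightarrow> ('a, 'b, 'd) module_scheme \<Rightarrow> 'b set \<Rightarrow> bool" where
  "small_submodule R M N \<longleftrightarrow>
     submodule N R M \<and>
     (\<forall>X. submodule X R M \<and> X \<noteq> carrier M \<longrightarrow> N <+>\<^bsub>M\<^esub> X \<noteq> carrier M)"

definition direct_summand ::
    "('a, 'c) ring_scheme \<Rightarrow> ('a, 'b, 'd) module_scheme \<Rightarrow> 'b set \<Rightarrow> bool" where
  "direct_summand R M D \<longleftrightarrow>
     submodule D R M \<and>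
     (\<exists>C. submodule C R M \<and> D <+>\<^bsub>M\<^esub> C = carrier M \<and> D \<inter> C = {\<zero>\<^bsub>M\<^esub>})"

definition H_supplemented ::
    "('a, 'c) ring_scheme \<Rightarrow> ('a, 'b, 'd) module_scheme \<Rightarrow> bool" where
  "H_supplemented R M \<longleftrightarrow>
     (\<forall>A. submodule A R M \<longrightarrow>
        (\<exists>A'. direct_summand R M A' \<and>
           (\<forall>X. submodule X R M \<longrightarrow>
              (A <+>\<^bsub>M\<^esub> X = carrier M \<longleftrightarrow> A' <+>\<^bsub>M\<^esub> X = carrier M))))"

definition amply_supplemented ::
    "('a, 'c) ring_scheme \<Rightarrow> ('a, 'b, 'd) module_scheme \<Rightarrow> bool" where
  "amply_supplemented R M \<longleftrightarrow>
     (\<forall>A B. submodule A R M \<and> submodule B R M \<and> A <+>\<^bsub>M\<^esub> B = carrier M \<longrightarrow>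
        (\<exists>P. submodule P R M \<and> P \<subseteq> B \<and> A <+>\<^bsub>M\<^esub> P = carrier M \<and>
           small_submodule R (M\<lparr>carrier := P\<rparr>) (A \<inter> P)))"

(* HOL cannot quantify existentially over types.  Elements of rings and modules are therefore
   drawn from one fixed type, of cardinality 2^(2^aleph_0).  The carriers are arbitrary subsets,
   so up to isomorphism every ring and module of at most that cardinality is available. *)

type_synonym element = "real set"

end

theory Submission
  imports Defs "HOL-Computational_Algebra.Polynomial" "HOL-Library.Product_Plus" "HOL-Library.Countable"
begin

text \<open>
Let \<open>S\<close> be the localization of the integers at 2 and \<open>F = S[y]\<close>. The ring is the trivial extension
\<open>R = S \<times> F\<close>, in which \<open>F\<close> is an ideal of square zero, and the module is \<open>M = \<rat> \<oplus> R\<close>, where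
\<open>F\<close> annihilates \<open>\<rat>\<close>. The summand \<open>R\<close> is local. The summand \<open>\<rat>\<close> is hollow, since the
\<open>S\<close>-submodules of the field of fractions of a valuation ring form a chain, and it has no maximal
submodule, since it is divisible by 2.

Such a sum of a local module and a hollow module without maximal submodules is H-supplemented,
because the two have no nonzero quotient in common. A submodule that projects onto both summands is
therefore all of \<open>M\<close> (\<open>eq_vecs_iff\<close>), and since both summands are hollow, \<open>Y + Z\<close> projects onto
a summand exactly if \<open>Y\<close> or \<open>Z\<close> does. So whether \<open>Y + Z = M\<close> depends on \<open>Y\<close> only through the
set of summands that it projects onto, and each of the four possible sets is realized by one of the
direct summands \<open>0\<close>, \<open>\<rat>\<close>, \<open>R\<close> and \<open>M\<close> (\<open>coord_equivalent\<close>).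

Ample supplementation fails because the radical \<open>2 S \<times> F\<close> of \<open>R\<close> contains a module that maps onto
\<open>\<rat>\<close>. Evaluation at \<open>1/2\<close> maps \<open>F\<close> onto \<open>S[1/2] = \<rat>\<close>; let \<open>B\<close> be the graph of this map, as a
submodule of \<open>\<rat> \<oplus> F\<close>. Then \<open>R + B = M\<close>. Suppose that \<open>P \<subseteq> B\<close> and \<open>R + P = M\<close>. Then \<open>P\<close>
projects onto \<open>\<rat>\<close>, which is divisible by 2, so \<open>(R \<inter> P) + 2 P = P\<close>
(\<open>ring_part_plus_doubles\<close>). If \<open>R \<inter> P\<close> were small in \<open>P\<close>, then \<open>2 P = P\<close>. But \<open>B\<close> is
isomorphic to \<open>F\<close>, which has no nonzero element divisible by all powers of 2 (\<open>doubles_proper\<close>).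

The argument is carried out on tuples of rationals and rational polynomials. These form a countable
type, and the example is moved to sets of reals only at the end.
\<close>

section \<open>The rationals with odd denominator\<close>

definition odd_denom :: "rat set" where
  "odd_denom = {q. \<exists>a b::int. odd b \<and> q = of_int a / of_int b}"

lemma odd_denom_of_int [simp]: "of_int n \<in> odd_denom"
  unfolding odd_denom_def by (rule CollectI, rule exI[of _ n], rule exI[of _ 1]) simp

lemma odd_denom_0 [simp]: "0 \<in> odd_denom" and odd_denom_1 [simp]: "1 \<in> odd_denom"
  and odd_denom_2 [simp]: "2 \<in> odd_denom"
  using odd_denom_of_int[of 0] odd_denom_of_int[of 1] odd_denom_of_int[of 2] by simp_all

lemma odd_denom_add [intro, simp]:
  assumes "x \<in> odd_denom" "y \<in> odd_denom"
  shows "x + y \<in> odd_denom"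
proof -
  obtain a b c d :: int where "odd b" "x = of_int a / of_int b" "odd d" "y = of_int c / of_int d"
    using assms unfolding odd_denom_def by blast
  moreover from this have "b \<noteq> 0" "d \<noteq> 0" by auto
  ultimately have "x + y = of_int (a * d + c * b) / of_int (b * d)" "odd (b * d)"
    by (auto simp: field_simps)
  then show ?thesis unfolding odd_denom_def by blast
qed

lemma odd_denom_mult [intro, simp]:
  assumes "x \<in> odd_denom" "y \<in> odd_denom"
  shows "x * y \<in> odd_denom"
proof -
  obtain a b c d :: int where "odd b" "x = of_int a / of_int b" "odd d" "y = of_int c / of_int d"
    using assms unfolding odd_denom_def by blast
  then have "x * y = of_int (a * c) / of_int (b * d)" "odd (b * d)"
    by auto
  then show ?thesis unfolding odd_denom_def by blast
qed

lemma odd_denom_uminus [intro, simp]: "x \<in> odd_denom \<Longrightarrow> - x \<in> odd_denom"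
  using odd_denom_mult[OF odd_denom_of_int[of "-1"]] by simp

lemma odd_denom_diff [intro, simp]:
  "x \<in> odd_denom \<Longrightarrow> y \<in> odd_denom \<Longrightarrow> x - y \<in> odd_denom"
  using odd_denom_add[OF _ odd_denom_uminus] by fastforce

lemma rat_eq_odd_denom_div_power_2:
  obtains s n where "s \<in> odd_denom" "q = s / 2 ^ n"
proof -
  obtain a b :: int where b: "b > 0" and q: "q = of_int a / of_int b"
    by (cases q) (auto simp: Fract_of_int_quotient)
  have "\<not> is_unit (2::int)" by simp
  then obtain d where d: "b = 2 ^ multiplicity 2 b * d" "odd d"
    using multiplicity_decompose'[of b 2] b by (metis less_irrefl)
  define n where "n = multiplicity 2 b"
  have "q = (of_int a / of_int d) / 2 ^ n"
    unfolding q by (subst d(1)) (simp add: n_def)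
  moreover have "of_int a / of_int d \<in> odd_denom"
    using d(2) unfolding odd_denom_def by blast
  ultimately show ?thesis using that by blast
qed

lemma odd_denom_half_or_unit:
  assumes "c \<in> odd_denom"
  obtains "c / 2 \<in> odd_denom" | "c \<noteq> 0" "inverse c \<in> odd_denom"
proof -
  obtain a b :: int where ab: "odd b" "c = of_int a / of_int b"
    using assms unfolding odd_denom_def by blast
  show ?thesis
  proof (cases "even a")
    case True
    then obtain k where "a = 2 * k" by blast
    with ab have "c / 2 = of_int k / of_int b" by simp
    with ab that(1) show ?thesis unfolding odd_denom_def by blast
  next
    case False
    moreover have "c \<noteq> 0" "inverse c = of_int b / of_int a" using ab False by auto
    ultimately show ?thesis using ab that(2) unfolding odd_denom_def by blast
  qed
qed

lemma half_notin_odd_denom: "1 / 2 \<notin> odd_denom"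
proof
  assume "1 / 2 \<in> odd_denom"
  then obtain a b :: int where ab: "odd b" "1 / 2 = (of_int a / of_int b :: rat)"
    unfolding odd_denom_def by blast
  then have "of_int b = (of_int (2 * a) :: rat)" by (auto simp: field_simps)
  then have "b = 2 * a" by (simp only: of_int_eq_iff)
  with ab show False by simp
qed

lemma odd_denom_unit_iff:
  assumes "c \<in> odd_denom"
  shows "c \<noteq> 0 \<and> inverse c \<in> odd_denom \<longleftrightarrow> c / 2 \<notin> odd_denom"
proof
  assume c: "c \<noteq> 0 \<and> inverse c \<in> odd_denom"
  show "c / 2 \<notin> odd_denom"
  proof
    assume "c / 2 \<in> odd_denom"
    then have "inverse c * (c / 2) \<in> odd_denom" using c by blast
    with c half_notin_odd_denom show False by simp
  qed
next
  assume "c / 2 \<notin> odd_denom"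
  with assms show "c \<noteq> 0 \<and> inverse c \<in> odd_denom"
    by (blast elim: odd_denom_half_or_unit)
qed

text \<open>This makes \<open>odd_denom\<close> a valuation ring of the rationals, which is why its
submodules of the rationals form a chain in \<open>covers_rat_sum_vecs\<close>.\<close>

lemma odd_denom_valuation:
  assumes "q \<noteq> 0"
  shows "q \<in> odd_denom \<or> inverse q \<in> odd_denom"
proof -
  obtain s n where s: "s \<in> odd_denom" "q = s / 2 ^ n"
    by (rule rat_eq_odd_denom_div_power_2)
  then show ?thesis using assms
  proof (induction n arbitrary: s)
    case (Suc n)
    from Suc.prems(1) show ?case
    proof (cases rule: odd_denom_half_or_unit)
      case 1
      then show ?thesis using Suc.IH[of "s / 2"] Suc.prems by simp
    next
      case 2
      have "inverse q = of_int (2 ^ Suc n) * inverse s"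
        using Suc.prems 2(1) by (simp add: field_simps)
      then show ?thesis using 2(2) odd_denom_mult[OF odd_denom_of_int] by metis
    qed
  qed simp
qed

text \<open>If \<open>x \<noteq> 0\<close>, its inverse is \<open>s / 2 ^ n\<close> with \<open>s\<close> in the ring, so divisibility of
\<open>x\<close> by \<open>2 ^ Suc n\<close> would put \<open>1 / 2\<close> into the ring.\<close>

lemma odd_denom_inf_divisible:
  assumes "\<And>n. x / 2 ^ n \<in> odd_denom"
  shows "x = 0"
proof (rule ccontr)
  assume "x \<noteq> 0"
  obtain s n where s: "s \<in> odd_denom" "inverse x = s / 2 ^ n"
    by (rule rat_eq_odd_denom_div_power_2)
  have "x / 2 ^ Suc n * s = x * inverse x / 2"
    unfolding s(2) by simp
  also have "\<dots> = 1 / 2" using \<open>x \<noteq> 0\<close> by simp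
  finally show False
    using odd_denom_mult[OF assms s(1), of "Suc n"] half_notin_odd_denom by metis
qed

definition odd_denom_poly :: "rat poly set" where
  "odd_denom_poly = {f. \<forall>n. coeff f n \<in> odd_denom}"

lemma odd_denom_poly_0 [simp]: "0 \<in> odd_denom_poly"
  and odd_denom_poly_add [simp]:
    "f \<in> odd_denom_poly \<Longrightarrow> g \<in> odd_denom_poly \<Longrightarrow> f + g \<in> odd_denom_poly"
  and odd_denom_poly_uminus [simp]: "f \<in> odd_denom_poly \<Longrightarrow> - f \<in> odd_denom_poly"
  and odd_denom_poly_diff [simp]:
    "f \<in> odd_denom_poly \<Longrightarrow> g \<in> odd_denom_poly \<Longrightarrow> f - g \<in> odd_denom_poly"
  and odd_denom_poly_smult [simp]:
    "s \<in> odd_denom \<Longrightarrow> f \<in> odd_denom_poly \<Longrightarrow> smult s f \<in> odd_denom_poly"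
  by (auto simp: odd_denom_poly_def)

text \<open>The monomial of degree \<open>n\<close> supplies the denominator \<open>2 ^ n\<close>.\<close>

lemma poly_half_surj:
  obtains f where "f \<in> odd_denom_poly" "poly f (1 / 2) = q"
proof -
  obtain s n where s: "s \<in> odd_denom" "q = s / 2 ^ n"
    by (rule rat_eq_odd_denom_div_power_2)
  show ?thesis
  proof
    show "monom s n \<in> odd_denom_poly" using s by (simp add: odd_denom_poly_def)
    show "poly (monom s n) (1 / 2) = q" using s by (simp add: poly_monom power_one_over)
  qed
qed

section \<open>The ring and the module\<close>

type_synonym scalar = "rat \<times> rat poly"
type_synonym vec = "rat \<times> rat \<times> rat poly"

definition scalars :: "scalar set" where
  "scalars = odd_denom \<times> odd_denom_poly"

fun smul :: "scalar \<Rightarrow> scalar \<Rightarrow> scalar" where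
  "smul (s, b) (t, c) = (s * t, smult s c + smult t b)"

definition vecs :: "vec set" where
  "vecs = UNIV \<times> scalars"

text \<open>The component \<open>snd v\<close> is an element of the ring, on which it acts by multiplication.\<close>

definition act :: "scalar \<Rightarrow> vec \<Rightarrow> vec" where
  "act r v = (fst r * fst v, smul (snd v) r)"

lemma act_simp [simp]: "act (s, b) (q, c, f) = (s * q, c * s, smult c b + smult s f)"
  by (simp add: act_def)

lemma mem_scalars [simp]: "(s, b) \<in> scalars \<longleftrightarrow> s \<in> odd_denom \<and> b \<in> odd_denom_poly"
  by (simp add: scalars_def)

lemma mem_vecs [simp]: "(q, c, f) \<in> vecs \<longleftrightarrow> c \<in> odd_denom \<and> f \<in> odd_denom_poly"
  by (simp add: vecs_def)

lemma zero_mem [simp]: "0 \<in> scalars" "0 \<in> vecs"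
  by (simp_all add: zero_prod_def)

lemma act_int:
  "act (of_int n, 0) v = (of_int n * fst v, of_int n * fst (snd v), smult (of_int n) (snd (snd v)))"
  by (cases v) simp

text \<open>These are the submodules; negatives come from the scalar \<open>-1\<close>.\<close>

definition closed_vecs :: "vec set \<Rightarrow> bool" where
  "closed_vecs Y \<longleftrightarrow> Y \<subseteq> vecs \<and> 0 \<in> Y \<and> (\<forall>v\<in>Y. \<forall>w\<in>Y. v + w \<in> Y) \<and>
     (\<forall>r\<in>scalars. \<forall>v\<in>Y. act r v \<in> Y)"

lemma closed_vecsD:
  assumes "closed_vecs Y"
  shows closed_vecs_sub: "Y \<subseteq> vecs" and closed_vecs_0: "0 \<in> Y"
    and closed_vecs_add: "v \<in> Y \<Longrightarrow> w \<in> Y \<Longrightarrow> v + w \<in> Y"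
    and closed_vecs_act: "r \<in> scalars \<Longrightarrow> v \<in> Y \<Longrightarrow> act r v \<in> Y"
  using assms unfolding closed_vecs_def by blast+

lemma closed_vecs_uminus:
  assumes "closed_vecs Y" "v \<in> Y"
  shows "- v \<in> Y"
proof -
  have "act (of_int (-1), 0) v = - v" by (cases v) (simp add: act_int)
  then show ?thesis using closed_vecs_act[OF assms(1) _ assms(2), of "(of_int (-1), 0)"] by simp
qed

lemma closed_vecs_diff:
  assumes "closed_vecs Y" "v \<in> Y" "w \<in> Y"
  shows "v - w \<in> Y"
  using closed_vecs_add[OF assms(1,2) closed_vecs_uminus[OF assms(1,3)]] by simp

definition sum_vecs :: "vec set \<Rightarrow> vec set \<Rightarrow> vec set" where
  "sum_vecs Y Z = {v + w |v w. v \<in> Y \<and> w \<in> Z}"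

lemma act_add: "act r (v + w) = act r v + act r w"
  by (cases r; cases v; cases w) (auto simp: algebra_simps smult_add_left smult_add_right)

lemma closed_vecs_vecs: "closed_vecs vecs"
  unfolding closed_vecs_def
proof (intro conjI ballI)
  fix v w assume "v \<in> vecs" "w \<in> vecs"
  then show "v + w \<in> vecs" by (cases v; cases w) auto
next
  fix r v assume "r \<in> scalars" "v \<in> vecs"
  then show "act r v \<in> vecs" by (cases r; cases v) auto
qed simp_all

lemma subset_sum_vecs:
  assumes "closed_vecs Y" "closed_vecs Z"
  shows "Y \<subseteq> sum_vecs Y Z" "Z \<subseteq> sum_vecs Y Z"
proof -
  have "v = v + 0" "v = 0 + v" for v :: vec by simp_all
  then show "Y \<subseteq> sum_vecs Y Z" "Z \<subseteq> sum_vecs Y Z"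
    using closed_vecs_0[OF assms(1)] closed_vecs_0[OF assms(2)] unfolding sum_vecs_def by blast+
qed

lemma closed_vecs_sum_vecs:
  assumes "closed_vecs Y" "closed_vecs Z"
  shows "closed_vecs (sum_vecs Y Z)"
  unfolding closed_vecs_def
proof (intro conjI ballI)
  show "sum_vecs Y Z \<subseteq> vecs"
    using closed_vecs_sub[OF assms(1)] closed_vecs_sub[OF assms(2)]
      closed_vecs_add[OF closed_vecs_vecs] unfolding sum_vecs_def by blast
  show "0 \<in> sum_vecs Y Z"
    using closed_vecs_0[OF assms(1)] subset_sum_vecs[OF assms] by blast
next
  fix v w assume "v \<in> sum_vecs Y Z" "w \<in> sum_vecs Y Z"
  then obtain a b c d where *: "v = a + b" "w = c + d" "a \<in> Y" "b \<in> Z" "c \<in> Y" "d \<in> Z"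
    unfolding sum_vecs_def by blast
  then have "v + w = (a + c) + (b + d)" by (simp add: algebra_simps)
  then show "v + w \<in> sum_vecs Y Z"
    using * assms closed_vecs_add unfolding sum_vecs_def by blast
next
  fix r v assume r: "r \<in> scalars" "v \<in> sum_vecs Y Z"
  then obtain a b where *: "v = a + b" "a \<in> Y" "b \<in> Z" unfolding sum_vecs_def by blast
  then show "act r v \<in> sum_vecs Y Z"
    using r assms closed_vecs_act act_add unfolding sum_vecs_def by blast
qed

section \<open>When a sum of submodules is everything\<close>

text \<open>The ring \<open>odd_denom\<close> is local with maximal ideal generated by 2, so the
condition says that the middle coordinate is a unit. As the ring of scalars is local with the same
residue field, a submodule has such an element exactly if it projects onto the ring summand.\<close>

definition has_unit :: "vec set \<Rightarrow> bool" where
  "has_unit Y \<longleftrightarrow> (\<exists>v\<in>Y. fst (snd v) / 2 \<notin> odd_denom)"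

definition covers_rat :: "vec set \<Rightarrow> bool" where
  "covers_rat Y \<longleftrightarrow> (\<forall>q. \<exists>v\<in>Y. fst v = q)"

text \<open>For the converse direction, \<open>Y\<close> contains \<open>(h, c, f)\<close> with \<open>c\<close> a unit, and an
element with first coordinate \<open>h / 2\<close>. Subtracting twice the latter kills the first coordinate and
changes \<open>c\<close> only by a multiple of 2, so it leaves a generator of the ring summand. This is where
divisibility of the rationals meets locality of the ring.\<close>

lemma eq_vecs_iff:
  assumes Y: "closed_vecs Y"
  shows "Y = vecs \<longleftrightarrow> has_unit Y \<and> covers_rat Y"
proof
  assume *: "Y = vecs"
  have "(0, 1, 0) \<in> Y" "\<And>q. (q, 0, 0) \<in> Y" unfolding * by simp_all
  then show "has_unit Y \<and> covers_rat Y"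
    unfolding has_unit_def covers_rat_def using half_notin_odd_denom by force
next
  assume *: "has_unit Y \<and> covers_rat Y"
  then obtain h c f where v: "(h, c, f) \<in> Y" "c / 2 \<notin> odd_denom"
    unfolding has_unit_def by (metis prod.collapse)
  from * obtain w where w: "w \<in> Y" "fst w = h / 2" unfolding covers_rat_def by blast
  then obtain d g where dg: "(h / 2, d, g) \<in> Y" by (metis prod.collapse)
  have c: "c \<in> odd_denom" "f \<in> odd_denom_poly" and d: "d \<in> odd_denom" "g \<in> odd_denom_poly"
    using closed_vecs_sub[OF Y] v dg by auto
  define e k where "e = c - 2 * d" and "k = f - smult 2 g"
  have "(h, c, f) - act (2, 0) (h / 2, d, g) \<in> Y"
    by (intro closed_vecs_diff[OF Y] v closed_vecs_act[OF Y] dg) simp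
  then have ek: "(0, e, k) \<in> Y" by (simp add: e_def k_def mult.commute)
  then have ekm: "e \<in> odd_denom" "k \<in> odd_denom_poly" using closed_vecs_sub[OF Y] by auto
  have "e / 2 \<notin> odd_denom"
  proof
    assume "e / 2 \<in> odd_denom"
    then have "e / 2 + d \<in> odd_denom" using d by blast
    with v(2) show False by (simp add: e_def diff_divide_distrib)
  qed
  then have e: "e \<noteq> 0" "inverse e \<in> odd_denom" using odd_denom_unit_iff ekm(1) by blast+
  have ring_part: "(0, s, b) \<in> Y" if "s \<in> odd_denom" "b \<in> odd_denom_poly" for s b
  proof -
    \<comment> \<open>Solve \<open>smul (e, k) (t, u) = (s, b)\<close>, first for \<open>t\<close> and then for \<open>u\<close>.\<close>
    define t where "t = inverse e * s"
    have t: "t \<in> odd_denom" using that e by (simp add: t_def)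
    have "smult (inverse e) (b - smult t k) \<in> odd_denom_poly" using that e ekm t by simp
    then have "act (t, smult (inverse e) (b - smult t k)) (0, e, k) \<in> Y"
      using ek t by (intro closed_vecs_act[OF Y]) simp_all
    moreover have "t * e = s" using e by (simp add: t_def)
    ultimately show ?thesis using e by (simp add: mult.commute)
  qed
  have "(q, s, b) \<in> Y" if "s \<in> odd_denom" "b \<in> odd_denom_poly" for q s b
  proof -
    from * obtain w where "w \<in> Y" "fst w = q" unfolding covers_rat_def by blast
    then obtain s' b' where w: "(q, s', b') \<in> Y" by (metis prod.collapse)
    then have m: "s' \<in> odd_denom" "b' \<in> odd_denom_poly" using closed_vecs_sub[OF Y] by auto
    have "(0, s + - s', b + - b') \<in> Y" using that m by (intro ring_part) auto
    from closed_vecs_add[OF Y w this] show ?thesis by simp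
  qed
  then show "Y = vecs" using closed_vecs_sub[OF Y] by (auto simp: vecs_def scalars_def)
qed

text \<open>A sum of two nonunits of a local ring is a nonunit.\<close>

lemma has_unit_sum_vecs:
  assumes Y: "closed_vecs Y" and Z: "closed_vecs Z"
  shows "has_unit (sum_vecs Y Z) \<longleftrightarrow> has_unit Y \<or> has_unit Z"
proof
  assume "has_unit (sum_vecs Y Z)"
  then obtain v w where vw: "v \<in> Y" "w \<in> Z" "fst (snd (v + w)) / 2 \<notin> odd_denom"
    unfolding has_unit_def sum_vecs_def by blast
  then have "fst (snd v) / 2 + fst (snd w) / 2 \<notin> odd_denom" by (simp add: add_divide_distrib)
  then show "has_unit Y \<or> has_unit Z" using vw unfolding has_unit_def by blast
next
  show "has_unit Y \<or> has_unit Z \<Longrightarrow> has_unit (sum_vecs Y Z)"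
    using subset_sum_vecs[OF Y Z] unfolding has_unit_def by blast
qed

lemma closed_vecs_fst_scale:
  assumes Y: "closed_vecs Y" and v: "v \<in> Y" and s: "s \<in> odd_denom"
  shows "\<exists>w\<in>Y. fst w = s * fst v"
proof (rule bexI)
  show "act (s, 0) v \<in> Y" using s by (intro closed_vecs_act[OF Y _ v]) simp
  show "fst (act (s, 0) v) = s * fst v" by (simp add: act_def)
qed

text \<open>The projections of the two submodules to the rationals are comparable, so the
projection of the sum is the larger one.\<close>

lemma covers_rat_sum_vecs:
  assumes Y: "closed_vecs Y" and Z: "closed_vecs Z"
  shows "covers_rat (sum_vecs Y Z) \<longleftrightarrow> covers_rat Y \<or> covers_rat Z"
proof
  assume cov: "covers_rat (sum_vecs Y Z)"
  have comparable: "fst ` Z \<subseteq> fst ` Y \<or> fst ` Y \<subseteq> fst ` Z"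
  proof (rule ccontr)
    assume "\<not> ?thesis"
    then obtain v w where v: "v \<in> Y" "fst v \<notin> fst ` Z" and w: "w \<in> Z" "fst w \<notin> fst ` Y"
      by blast
    have "0 \<in> fst ` Z" "0 \<in> fst ` Y"
      using closed_vecs_0[OF Y] closed_vecs_0[OF Z] by force+
    then have nz: "fst v \<noteq> 0" "fst w \<noteq> 0" using v w by metis+
    then have "fst v / fst w \<in> odd_denom \<or> fst w / fst v \<in> odd_denom"
      using odd_denom_valuation[of "fst v / fst w"] by (simp add: inverse_eq_divide)
    then show False
    proof
      assume "fst v / fst w \<in> odd_denom"
      from closed_vecs_fst_scale[OF Z w(1) this] show False using v(2) nz by (auto simp: image_iff)
    next
      assume "fst w / fst v \<in> odd_denom"
      from closed_vecs_fst_scale[OF Y v(1) this] show False using w(2) nz by (auto simp: image_iff)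
    qed
  qed
  have covers: "covers_rat X"
    if X: "closed_vecs X" and le: "fst ` Y \<subseteq> fst ` X" "fst ` Z \<subseteq> fst ` X" for X
    unfolding covers_rat_def
  proof
    fix q
    from cov obtain u where "u \<in> sum_vecs Y Z" "fst u = q"
      unfolding covers_rat_def by blast
    then obtain v w where vw: "v \<in> Y" "w \<in> Z" "fst (v + w) = q"
      unfolding sum_vecs_def by blast
    obtain a where "a \<in> X" "fst a = fst v" using le(1) vw(1) by force
    moreover obtain b where "b \<in> X" "fst b = fst w" using le(2) vw(2) by force
    ultimately have "a + b \<in> X" "fst (a + b) = q" using closed_vecs_add[OF X] vw by auto
    then show "\<exists>v\<in>X. fst v = q" by blast
  qed
  show "covers_rat Y \<or> covers_rat Z" using comparable covers[OF Y] covers[OF Z] by blast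
next
  show "covers_rat Y \<or> covers_rat Z \<Longrightarrow> covers_rat (sum_vecs Y Z)"
    using subset_sum_vecs[OF Y Z] unfolding covers_rat_def by blast
qed

lemma sum_vecs_eq_vecs_iff:
  assumes "closed_vecs Y" "closed_vecs Z"
  shows "sum_vecs Y Z = vecs \<longleftrightarrow> (has_unit Y \<or> has_unit Z) \<and> (covers_rat Y \<or> covers_rat Z)"
  using assms by (simp add: eq_vecs_iff closed_vecs_sum_vecs has_unit_sum_vecs covers_rat_sum_vecs)

text \<open>The flags are the intended values of \<open>has_unit\<close> and \<open>covers_rat\<close>.\<close>

definition coord :: "bool \<Rightarrow> bool \<Rightarrow> vec set" where
  "coord p q = {v \<in> vecs. (p \<or> snd v = 0) \<and> (q \<or> fst v = 0)}"

lemma closed_vecs_coord: "closed_vecs (coord p q)"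
  unfolding closed_vecs_def
proof (intro conjI ballI)
  show "coord p q \<subseteq> vecs" "0 \<in> coord p q" by (auto simp: coord_def)
next
  fix v w assume "v \<in> coord p q" "w \<in> coord p q"
  then show "v + w \<in> coord p q"
    using closed_vecs_add[OF closed_vecs_vecs] by (auto simp: coord_def simp del: split_paired_All)
next
  fix r v assume "r \<in> scalars" "v \<in> coord p q"
  then show "act r v \<in> coord p q"
    by (cases r; cases v) (auto simp: coord_def zero_prod_def)
qed

lemma has_unit_coord: "has_unit (coord p q) \<longleftrightarrow> p"
proof
  show "has_unit (coord p q) \<Longrightarrow> p" by (auto simp: has_unit_def coord_def zero_prod_def)
next
  assume p
  then have "(0, 1, 0) \<in> coord p q" by (simp add: coord_def)
  then show "has_unit (coord p q)" unfolding has_unit_def using half_notin_odd_denom by force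
qed

lemma covers_rat_coord: "covers_rat (coord p q) \<longleftrightarrow> q"
proof
  show "covers_rat (coord p q) \<Longrightarrow> q" unfolding covers_rat_def
    by (drule spec[of _ 1]) (auto simp: coord_def)
next
  assume q
  then have "(x, 0, 0) \<in> coord p q" for x by (simp add: coord_def zero_prod_def)
  then show "covers_rat (coord p q)" unfolding covers_rat_def by force
qed

lemma coord_summand:
  "sum_vecs (coord p q) (coord (\<not> p) (\<not> q)) = vecs" "coord p q \<inter> coord (\<not> p) (\<not> q) = {0}"
proof -
  show "sum_vecs (coord p q) (coord (\<not> p) (\<not> q)) = vecs"
    by (simp add: sum_vecs_eq_vecs_iff closed_vecs_coord has_unit_coord covers_rat_coord)
  show "coord p q \<inter> coord (\<not> p) (\<not> q) = {0}"
    by (auto simp: coord_def prod_eq_iff)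
qed

lemma coord_equivalent:
  assumes "closed_vecs Y"
  obtains p q where
    "\<And>Z. closed_vecs Z \<Longrightarrow> sum_vecs Y Z = vecs \<longleftrightarrow> sum_vecs (coord p q) Z = vecs"
  using assms that[of "has_unit Y" "covers_rat Y"]
  by (simp add: sum_vecs_eq_vecs_iff closed_vecs_coord has_unit_coord covers_rat_coord)

section \<open>A submodule containing no supplement\<close>

definition graph_half :: "vec set" where
  "graph_half = {(poly f (1 / 2), 0, f) |f. f \<in> odd_denom_poly}"

lemma closed_vecs_graph_half: "closed_vecs graph_half"
  unfolding closed_vecs_def
proof (intro conjI ballI)
  show "graph_half \<subseteq> vecs" by (auto simp: graph_half_def)
  show "0 \<in> graph_half" by (auto simp: graph_half_def zero_prod_def intro!: exI[of _ 0])
next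
  fix v w assume "v \<in> graph_half" "w \<in> graph_half"
  then obtain f g where "v = (poly f (1 / 2), 0, f)" "f \<in> odd_denom_poly"
    "w = (poly g (1 / 2), 0, g)" "g \<in> odd_denom_poly" unfolding graph_half_def by blast
  then show "v + w \<in> graph_half" unfolding graph_half_def by (auto intro!: exI[of _ "f + g"])
next
  fix r v assume "r \<in> scalars" "v \<in> graph_half"
  then obtain f s b where "v = (poly f (1 / 2), 0, f)" "f \<in> odd_denom_poly"
    "r = (s, b)" "s \<in> odd_denom" unfolding graph_half_def by (cases r) auto
  then show "act r v \<in> graph_half"
    unfolding graph_half_def by (auto intro!: exI[of _ "smult s f"])
qed

lemma covers_rat_graph_half: "covers_rat graph_half"
  unfolding covers_rat_def graph_half_def
proof
  fix q
  obtain f where "f \<in> odd_denom_poly" "poly f (1 / 2) = q" by (rule poly_half_surj)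
  then show "\<exists>v\<in>{(poly f (1 / 2), 0, f) |f. f \<in> odd_denom_poly}. fst v = q" by force
qed

definition doubles :: "vec set \<Rightarrow> vec set" where
  "doubles P = act (2, 0) ` P"

lemma act_comm_2: "act r (act (2, 0) v) = act (2, 0) (act r v)"
  by (cases r; cases v) (simp add: algebra_simps smult_add_right)

lemma doubles_subset: "closed_vecs P \<Longrightarrow> doubles P \<subseteq> P"
  unfolding doubles_def by (intro image_subsetI closed_vecs_act) simp_all

lemma closed_vecs_doubles:
  assumes P: "closed_vecs P"
  shows "closed_vecs (doubles P)"
  unfolding closed_vecs_def
proof (intro conjI ballI)
  show "doubles P \<subseteq> vecs" using doubles_subset[OF P] closed_vecs_sub[OF P] by blast
  have "0 = act (2, 0) 0" by (simp add: zero_prod_def)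
  then show "0 \<in> doubles P" using closed_vecs_0[OF P] unfolding doubles_def by (rule image_eqI)
next
  fix v w assume "v \<in> doubles P" "w \<in> doubles P"
  then obtain a b where "v = act (2, 0) a" "a \<in> P" "w = act (2, 0) b" "b \<in> P"
    unfolding doubles_def by blast
  then have "v + w = act (2, 0) (a + b)" "a + b \<in> P"
    using closed_vecs_add[OF P] by (simp_all only: act_add)
  then show "v + w \<in> doubles P" unfolding doubles_def by (rule image_eqI)
next
  fix r v assume "r \<in> scalars" "v \<in> doubles P"
  then obtain a where "v = act (2, 0) a" "a \<in> P" unfolding doubles_def by blast
  then have "act r v = act (2, 0) (act r a)" "act r a \<in> P"
    using closed_vecs_act[OF P \<open>r \<in> scalars\<close>] by (simp_all only: act_comm_2)
  then show "act r v \<in> doubles P" unfolding doubles_def by (rule image_eqI)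
qed

text \<open>Otherwise every element of \<open>P\<close> has a polynomial part divisible by all powers of 2.
Then this part is zero, and with it the whole element, as it lies on a graph over the polynomials.\<close>

lemma doubles_proper:
  assumes P: "closed_vecs P" and sub: "P \<subseteq> graph_half" and cov: "covers_rat P"
  shows "doubles P \<noteq> P"
proof
  assume eq: "doubles P = P"
  have div: "\<exists>w\<in>P. snd (snd v) = smult (2 ^ n) (snd (snd w))" if "v \<in> P" for v n
    using that
  proof (induction n arbitrary: v)
    case 0
    then show ?case by auto
  next
    case (Suc n)
    then obtain w where w: "w \<in> P" "v = act (2, 0) w" using eq unfolding doubles_def by blast
    from Suc.IH[OF w(1)] obtain u where "u \<in> P" "snd (snd w) = smult (2 ^ n) (snd (snd u))" by blast
    then show ?case using w(2) by (cases w) auto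
  qed
  have "snd (snd v) = 0" if v: "v \<in> P" for v
  proof (rule poly_eqI)
    fix i
    have "coeff (snd (snd v)) i / 2 ^ n \<in> odd_denom" for n
    proof -
      obtain w where w: "w \<in> P" "snd (snd v) = smult (2 ^ n) (snd (snd w))"
        using div[OF v] by blast
      then have "coeff (snd (snd v)) i / 2 ^ n = coeff (snd (snd w)) i" by simp
      moreover have "snd (snd w) \<in> odd_denom_poly"
        using w(1) closed_vecs_sub[OF P] by (cases w) auto
      ultimately show ?thesis by (simp add: odd_denom_poly_def)
    qed
    then show "coeff (snd (snd v)) i = coeff 0 i" using odd_denom_inf_divisible by simp
  qed
  then have "fst v = 0" if "v \<in> P" for v
    using that sub unfolding graph_half_def by fastforce
  moreover from cov obtain v where "v \<in> P" "fst v = 1" unfolding covers_rat_def by blast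
  ultimately show False by simp
qed

text \<open>If \<open>w \<in> P\<close> has half the first coordinate of \<open>v\<close>, then \<open>v - 2 w\<close> has first
coordinate zero.\<close>

lemma ring_part_plus_doubles:
  assumes P: "closed_vecs P" and sub: "P \<subseteq> graph_half" and cov: "covers_rat P"
  shows "sum_vecs (coord True False \<inter> P) (doubles P) = P"
proof (intro equalityI subsetI)
  fix v assume "v \<in> sum_vecs (coord True False \<inter> P) (doubles P)"
  then show "v \<in> P"
    using doubles_subset[OF P] closed_vecs_add[OF P] unfolding sum_vecs_def by blast
next
  fix v assume v: "v \<in> P"
  from cov obtain w where w: "w \<in> P" "fst w = fst v / 2" unfolding covers_rat_def by blast
  define u where "u = v - act (2, 0) w"
  have "act (2, 0) w \<in> P" by (intro closed_vecs_act[OF P _ w(1)]) simp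
  then have uP: "u \<in> P" unfolding u_def by (rule closed_vecs_diff[OF P v])
  have "fst u = 0" using w(2) by (simp add: u_def act_def)
  then have "u \<in> coord True False" using uP closed_vecs_sub[OF P] by (auto simp: coord_def)
  moreover have "v = u + act (2, 0) w" by (simp add: u_def)
  ultimately show "v \<in> sum_vecs (coord True False \<inter> P) (doubles P)"
    using uP w(1) unfolding sum_vecs_def doubles_def by blast
qed

section \<open>Carrying the example over to sets of reals\<close>

instance poly :: ("{countable, zero}") countable
proof (rule countable_classI)
  fix p q :: "'a poly"
  show "to_nat (coeffs p) = to_nat (coeffs q) \<Longrightarrow> p = q" by (simp add: coeffs_eq_iff)
qed

definition encode :: "'a::countable \<Rightarrow> element" where
  "encode x = {real (to_nat x)}"

lemma encode_eq [simp]: "encode x = encode y \<longleftrightarrow> x = y"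
  by (simp add: encode_def)

lemma inj_encode: "inj encode"
  by (simp add: inj_def)

lemma encode_mem [simp]: "encode x \<in> encode ` Y \<longleftrightarrow> x \<in> Y"
  by (rule inj_image_mem_iff[OF inj_encode])

definition decode :: "element \<Rightarrow> 'a::countable" where
  "decode = inv_into UNIV encode"

lemma decode_encode [simp]: "decode (encode x) = x"
  unfolding decode_def by (rule inv_f_f[OF inj_encode])

definition ring_ex :: "element ring" where
  "ring_ex = \<lparr>carrier = encode ` scalars,
     monoid.mult = \<lambda>x y. encode (smul (decode x) (decode y)), one = encode (1 :: rat, 0 :: rat poly),
     zero = encode (0 :: scalar), add = \<lambda>x y. encode (decode x + decode y :: scalar)\<rparr>"

text \<open>The record type of modules extends that of rings, so the ring multiplication and its
unit have to be filled with arbitrary values.\<close>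

definition module_ex :: "(element, element) module" where
  "module_ex = \<lparr>carrier = encode ` vecs,
     monoid.mult = \<lambda>x y. undefined, one = undefined,
     zero = encode (0 :: vec), add = \<lambda>x y. encode (decode x + decode y :: vec),
      module.smult = \<lambda>a x. encode (act (decode a) (decode x))\<rparr>"

lemma ring_ex_simps [simp]:
  "carrier ring_ex = encode ` scalars" "\<one>\<^bsub>ring_ex\<^esub> = encode (1 :: rat, 0 :: rat poly)"
  "\<zero>\<^bsub>ring_ex\<^esub> = encode (0 :: scalar)"
  "encode r \<otimes>\<^bsub>ring_ex\<^esub> encode r' = encode (smul r r')"
  "encode r \<oplus>\<^bsub>ring_ex\<^esub> encode r' = encode (r + r')"
  by (simp_all add: ring_ex_def)

lemma module_ex_simps [simp]:
  "carrier module_ex = encode ` vecs" "\<zero>\<^bsub>module_ex\<^esub> = encode (0 :: vec)"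
  "encode v \<oplus>\<^bsub>module_ex\<^esub> encode v' = encode (v + v')"
  "encode r \<odot>\<^bsub>module_ex\<^esub> encode v = encode (act r v)"
  by (simp_all add: module_ex_def)

lemma scalars_add: "r \<in> scalars \<Longrightarrow> r' \<in> scalars \<Longrightarrow> r + r' \<in> scalars"
  and scalars_uminus: "r \<in> scalars \<Longrightarrow> - r \<in> scalars"
  and scalars_mult: "r \<in> scalars \<Longrightarrow> r' \<in> scalars \<Longrightarrow> smul r r' \<in> scalars"
  by (cases r; cases r'; simp)+

lemma smul_assoc: "smul (smul a b) c = smul a (smul b c)"
  by (cases a; cases b; cases c) (simp add: algebra_simps smult_add_right)

lemma smul_distrib: "smul (a + b) c = smul a c + smul b c" "smul a (b + c) = smul a b + smul a c"
  by (cases a; cases b; cases c; simp add: algebra_simps smult_add_left smult_add_right)+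

lemma smul_one: "smul (1, 0) a = a" "smul a (1, 0) = a"
  by (cases a; simp)+

lemma fst_smul: "fst (smul a b) = fst a * fst b"
  by (cases a; cases b) simp

lemma ring_ring_ex: "ring ring_ex"
proof (rule ringI)
  show "abelian_group ring_ex"
  proof (rule abelian_groupI)
    fix x assume "x \<in> carrier ring_ex"
    then obtain r where "r \<in> scalars" "x = encode r" by auto
    then show "\<exists>y\<in>carrier ring_ex. y \<oplus>\<^bsub>ring_ex\<^esub> x = \<zero>\<^bsub>ring_ex\<^esub>"
      by (intro bexI[of _ "encode (- r)"]) (auto intro: scalars_uminus)
  qed (simp only: ring_ex_simps, (elim imageE)?, simp add: scalars_add add_ac)+
  show "monoid ring_ex"
    by (rule monoidI; simp only: ring_ex_simps, (elim imageE)?,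
        simp add: scalars_mult smul_assoc smul_one)
qed (simp only: ring_ex_simps, elim imageE, simp add: smul_distrib)+

lemma act_add_scalar: "act (a + b) v = act a v + act b v"
  and act_smul: "act (smul a b) v = act b (act a v)"
  and act_one: "act (1, 0) v = v"
  by (simp_all add: act_def distrib_right smul_distrib smul_assoc smul_one fst_smul)

lemma right_module_ex: "right_module ring_ex module_ex"
proof (intro right_module.intro right_module_axioms.intro ring_ring_ex)
  show "abelian_group module_ex"
  proof (rule abelian_groupI)
    fix x assume "x \<in> carrier module_ex"
    then obtain v where "v \<in> vecs" "x = encode v" by auto
    then show "\<exists>y\<in>carrier module_ex. y \<oplus>\<^bsub>module_ex\<^esub> x = \<zero>\<^bsub>module_ex\<^esub>"
      by (intro bexI[of _ "encode (- v)"]) (auto intro: closed_vecs_uminus[OF closed_vecs_vecs])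
  qed (simp only: module_ex_simps, (elim imageE)?,
       simp add: closed_vecs_add[OF closed_vecs_vecs] add_ac)+
qed (simp only: module_ex_simps ring_ex_simps, (elim imageE)?,
     simp add: closed_vecs_act[OF closed_vecs_vecs] act_add act_add_scalar act_smul act_one)+

lemma submodule_encodeI:
  assumes Y: "closed_vecs Y"
  shows "submodule (encode ` Y) ring_ex module_ex"
proof -
  interpret right_module ring_ex module_ex by (rule right_module_ex)
  show ?thesis
  proof (intro submodule.intro subgroup.intro submodule_axioms.intro)
    show "encode ` Y \<subseteq> carrier (add_monoid module_ex)" using closed_vecs_sub[OF Y] by auto
    show "\<one>\<^bsub>add_monoid module_ex\<^esub> \<in> encode ` Y" using closed_vecs_0[OF Y] by auto
    show "x \<otimes>\<^bsub>add_monoid module_ex\<^esub> y \<in> encode ` Y" if "x \<in> encode ` Y" "y \<in> encode ` Y" for x y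
      using that closed_vecs_add[OF Y] by auto
    show "inv\<^bsub>add_monoid module_ex\<^esub> x \<in> encode ` Y" if x: "x \<in> encode ` Y" for x
    proof -
      from x obtain v where v: "v \<in> Y" "x = encode v" by blast
      have v': "v \<in> vecs" "- v \<in> vecs"
        using closed_vecs_uminus[OF Y v(1)] v(1) closed_vecs_sub[OF Y] by blast+
      have "inv\<^bsub>add_monoid module_ex\<^esub> x = encode (- v)"
        using v v' by (intro group.inv_equality[OF M.a_group]) auto
      then show ?thesis using closed_vecs_uminus[OF Y] v by auto
    qed
    show "a \<odot>\<^bsub>module_ex\<^esub> x \<in> encode ` Y" if "a \<in> carrier ring_ex" "x \<in> encode ` Y" for a x
      using that closed_vecs_act[OF Y] by auto
  qed
qed

lemma submodule_encodeE:
  assumes X: "submodule X ring_ex module_ex"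
  obtains Y where "closed_vecs Y" "X = encode ` Y"
proof
  interpret submodule X ring_ex module_ex by (rule X)
  have sub: "X \<subseteq> encode ` vecs" using subset by simp
  show "X = encode ` {v :: vec. encode v \<in> X}" using sub by auto
  show "closed_vecs {v. encode v \<in> X}"
    unfolding closed_vecs_def
  proof (intro conjI ballI)
    show "{v. encode v \<in> X} \<subseteq> vecs" using sub by auto
    show "(0 :: vec) \<in> {v. encode v \<in> X}" using one_closed by simp
    show "v + w \<in> {v. encode v \<in> X}" if "v \<in> {v. encode v \<in> X}" "w \<in> {v. encode v \<in> X}" for v w :: vec
      using that m_closed[of "encode v" "encode w"] by simp
    show "act r v \<in> {v. encode v \<in> X}" if "r \<in> scalars" "v \<in> {v. encode v \<in> X}" for r and v :: vec
      using that smult_closed[of "encode r" "encode v"] by simp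
  qed
qed

lemma set_add_encode:
  "encode ` Y <+>\<^bsub>module_ex\<^esub> encode ` Z = encode ` sum_vecs Y Z"
  "encode ` Y <+>\<^bsub>module_ex\<lparr>carrier := C\<rparr>\<^esub> encode ` Z = encode ` sum_vecs Y Z"
proof -
  have "sum_vecs Y Z = (\<Union>v\<in>Y. \<Union>w\<in>Z. {v + w})" unfolding sum_vecs_def by blast
  then show "encode ` Y <+>\<^bsub>module_ex\<^esub> encode ` Z = encode ` sum_vecs Y Z"
    "encode ` Y <+>\<^bsub>module_ex\<lparr>carrier := C\<rparr>\<^esub> encode ` Z = encode ` sum_vecs Y Z"
    by (simp_all add: set_add_def' image_UN)
qed

lemma encode_image_eq [simp]: "encode ` Y = encode ` Z \<longleftrightarrow> Y = Z"
  by (rule inj_image_eq_iff[OF inj_encode])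

lemma direct_summand_coord: "direct_summand ring_ex module_ex (encode ` coord p q)"
  unfolding direct_summand_def
proof (intro conjI exI[of _ "encode ` coord (\<not> p) (\<not> q)"])
  show "encode ` coord p q \<inter> encode ` coord (\<not> p) (\<not> q) = {\<zero>\<^bsub>module_ex\<^esub>}"
    unfolding image_Int[OF inj_encode, symmetric] coord_summand by simp
qed (simp_all add: submodule_encodeI closed_vecs_coord set_add_encode coord_summand)

lemma H_supplemented_ex: "H_supplemented ring_ex module_ex"
  unfolding H_supplemented_def
proof (intro allI impI)
  fix A assume "submodule A ring_ex module_ex"
  then obtain Y where Y: "closed_vecs Y" "A = encode ` Y" by (rule submodule_encodeE)
  then obtain p q where pq:
    "\<And>Z. closed_vecs Z \<Longrightarrow> sum_vecs Y Z = vecs \<longleftrightarrow> sum_vecs (coord p q) Z = vecs"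
    using coord_equivalent by blast
  have "A <+>\<^bsub>module_ex\<^esub> X = carrier module_ex \<longleftrightarrow>
      encode ` coord p q <+>\<^bsub>module_ex\<^esub> X = carrier module_ex"
    if X: "submodule X ring_ex module_ex" for X
  proof -
    from X obtain Z where "closed_vecs Z" "X = encode ` Z" by (rule submodule_encodeE)
    then show ?thesis using pq by (simp add: Y(2) set_add_encode)
  qed
  then show "\<exists>A'. direct_summand ring_ex module_ex A' \<and>
      (\<forall>X. submodule X ring_ex module_ex \<longrightarrow>
        (A <+>\<^bsub>module_ex\<^esub> X = carrier module_ex \<longleftrightarrow> A' <+>\<^bsub>module_ex\<^esub> X = carrier module_ex))"
    using direct_summand_coord by blast
qed

lemma not_amply_supplemented_ex: "\<not> amply_supplemented ring_ex module_ex"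
proof
  interpret right_module ring_ex module_ex by (rule right_module_ex)
  let ?A = "coord True False"
  assume "amply_supplemented ring_ex module_ex"
  then have "submodule (encode ` ?A) ring_ex module_ex \<and>
      submodule (encode ` graph_half) ring_ex module_ex \<and>
      encode ` ?A <+>\<^bsub>module_ex\<^esub> encode ` graph_half = carrier module_ex \<longrightarrow>
    (\<exists>P. submodule P ring_ex module_ex \<and> P \<subseteq> encode ` graph_half \<and>
      encode ` ?A <+>\<^bsub>module_ex\<^esub> P = carrier module_ex \<and>
      small_submodule ring_ex (module_ex\<lparr>carrier := P\<rparr>) (encode ` ?A \<inter> P))"
    unfolding amply_supplemented_def by (elim allE)
  moreover have "submodule (encode ` ?A) ring_ex module_ex"
    "submodule (encode ` graph_half) ring_ex module_ex"
    by (intro submodule_encodeI closed_vecs_coord closed_vecs_graph_half)+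
  moreover have "encode ` ?A <+>\<^bsub>module_ex\<^esub> encode ` graph_half = carrier module_ex"
    by (simp add: set_add_encode sum_vecs_eq_vecs_iff closed_vecs_coord closed_vecs_graph_half
        has_unit_coord covers_rat_graph_half)
  ultimately obtain Q where Q: "submodule Q ring_ex module_ex" "Q \<subseteq> encode ` graph_half"
    "encode ` ?A <+>\<^bsub>module_ex\<^esub> Q = carrier module_ex"
    "small_submodule ring_ex (module_ex\<lparr>carrier := Q\<rparr>) (encode ` ?A \<inter> Q)"
    by blast
  from Q(1) obtain P where P: "closed_vecs P" "Q = encode ` P" by (rule submodule_encodeE)
  have sub: "P \<subseteq> graph_half" using Q(2) P(2) by auto
  have cov: "covers_rat P"
    using Q(3) P by (simp add: set_add_encode sum_vecs_eq_vecs_iff closed_vecs_coord covers_rat_coord)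
  have D: "submodule (encode ` doubles P) ring_ex module_ex"
    by (intro submodule_encodeI closed_vecs_doubles P)
  have "subgroup (encode ` doubles P) (add_monoid module_ex\<lparr>carrier := Q\<rparr>)"
    using submodule.axioms(1)[OF D] submodule.axioms(1)[OF Q(1)] doubles_subset[OF P(1)] P(2)
    by (intro group.subgroup_incl[OF M.a_group]) auto
  then have "submodule (encode ` doubles P) ring_ex (module_ex\<lparr>carrier := Q\<rparr>)"
    using submodule.smult_closed[OF D] by (intro submodule.intro submodule_axioms.intro) simp_all
  moreover have "(encode ` ?A \<inter> Q) <+>\<^bsub>module_ex\<lparr>carrier := Q\<rparr>\<^esub> encode ` doubles P = Q"
    unfolding P(2) image_Int[OF inj_encode, symmetric] set_add_encode
    using ring_part_plus_doubles[OF P(1) sub cov] by simp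
  moreover have "encode ` doubles P \<noteq> Q"
    using doubles_proper[OF P(1) sub cov] P(2) by simp
  ultimately show False using Q(4) unfolding small_submodule_def by simp
qed

theorem mainTheorem1:
  shows "\<exists>(R :: element ring) (M :: (element, element) module).
    right_module R M \<and> H_supplemented R M \<and> \<not> amply_supplemented R M"
  using right_module_ex H_supplemented_ex not_amply_supplemented_ex by blast

end
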